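(* Consider $N$ agents with dynamics $\dot x_i(t)=u_i(t)$, $x_i(t)\in\mathbb{R}$, and control law $u_i(t)=-\sum_{j\in\mathcal{N}_i^{\mathrm{out}}}w_{ij}(\hat x_i(t)-\hat x_j(t))$, $i\in\{1,\dots,N\}$, executing the event-triggered communication and control law (defined in the context) over a weight-balanced, strongly connected digraph $\mathcal{G}$. Then all agents exponentially converge to the average of the initial states, i.e., $\lim_{t\to\infty}x(t)=\bar x$ with exponential rate of convergence, where $x=(x_1,\dots,x_N)$ and $\bar x=\frac1N(\mathbf{1}_N^Tx(0))\mathbf{1}_N$.
   Context: A weighted digraph $\mathcal{G}=(V,E,W)$ has vertices $V=\{1,\dots,N\}$, directed edges $E\subset V\times V$ and weighted adjacency matrix $W=(w_{ij})\in\mathbb{R}_{\ge0}^{N\times N}$ with $w_{ij}>0$ if $(i,j)\in E$ and $w_{ij}=0$ otherwise. If $(i,j)\in E$, $j$ is an out-neighbor of $i$ and $i$ an in-neighbor of $j$; $\mathcal{N}_i^{\mathrm{out}}$ and $\mathcal{N}_i^{\mathrm{in}}$ are the sets of out- and in-neighbors of $i$, and $d_i^{\mathrm{out}}=\sum_{j\in\mathcal{N}_i^{\mathrm{out}}}w_{ij}$. The digraph is weight-balanced if $\sum_{j\in\mathcal{N}_i^{\mathrm{out}}}w_{ij}=\sum_{j\in\mathcal{N}_i^{\mathrm{in}}}w_{ji}$ for every $i$, and strongly connected if there is a directed path from every vertex to every other. $\mathbf{1}_N\in\mathbb{R}^N$ is the all-ones vector. Exponential convergence means that there exist constants $c,\alpha>0$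 with $\|x(t)-\bar x\|\le c\,e^{-\alpha t}$ for all $t\ge0$ (Euclidean norm). Communication: agent $i$ sends information to the agents in $\mathcal{N}_i^{\mathrm{in}}$ and receives information from the agents in $\mathcal{N}_i^{\mathrm{out}}$; broadcasts are received instantaneously. $\hat x_i(t)$ denotes the last broadcast state of agent $i$ at time $t\ge0$, so it is constant between consecutive broadcasts of agent $i$ and is reset to the current state $x_i$ when $i$ broadcasts. Each agent has continuous access to its own state. Set $e_i(t)=\hat x_i(t)-x_i(t)$. Design parameters: for each $i$, $\sigma_i\in(0,1)$ and $\varepsilon_i>0$ with $$\varepsilon_i<\sqrt{\frac{\sigma_i}{4d_i^{\mathrm{out}}w_i^{\max}|\mathcal{N}_i^{\mathrm{out}}|}},\qquad w_i^{\max}=\max_{j\in\mathcal{N}_i^{\mathrm{out}}}w_{ij}.$$ Define $$\phi_i=\sum_{j\in\mathcal{N}_i^{\mathrm{out}}}w_{ij}(\hat x_i-\hat x_j)^2,\qquad f_i(e_i)=e_i^2-\frac{\sigma_i}{4d_i^{\mathrm{out}}}\phi_i .$$ Event-triggered communication and control law: at all times $t$, each agent $i$ does the following. (1) If $f_i(e_i(t))>0$, or if $f_i(e_i(t))=0$ and $\phi_i(t)\ne0$, then agent $i$ broadcasts its state $x_i(t)$ and updates its control signal. (2) If agent $i$ receives new information $x_j(t)$ from some neighbor $j\in\mathcal{N}_i^{\mathrm{out}}$, then, letting $t_{\mathrm{last}}^i$ be the last time at which agent $i$ broadcast its state, agent $i$ immediately broadcasts its state $x_i(t)$ if $t\in(t_{\mathrm{last}}^i,t_{\mathrm{last}}^i+\varepsilon_i)$;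 in any case, it updates its control signal. By design, the triggers in (1) are such that the condition $f_i(e_i(t))\le0$ is enforced by each agent at all times. *)

theory Defs
  imports "HOL-Analysis.Analysis"
begin

section \<open>Weighted digraphs on a finite vertex type\<close>

definition weighted_digraph :: "('n::finite \<times> 'n) set \<Rightarrow> real^'n^'n \<Rightarrow> bool" where
  "weighted_digraph E W \<longleftrightarrow>
     (\<forall>i j. ((i, j) \<in> E \<longrightarrow> W $ i $ j > 0) \<and> ((i, j) \<notin> E \<longrightarrow> W $ i $ j = 0))"

definition out_nbrs :: "('n \<times> 'n) set \<Rightarrow> 'n \<Rightarrow> 'n set" where
  "out_nbrs E i = {j. (i, j) \<in> E}"

definition in_nbrs :: "('n \<times> 'n) set \<Rightarrow> 'n \<Rightarrow> 'n set" where
  "in_nbrs E i = {j. (j, i) \<in> E}"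

definition out_degree :: "('n::finite \<times> 'n) set \<Rightarrow> real^'n^'n \<Rightarrow> 'n \<Rightarrow> real" where
  "out_degree E W i = (\<Sum>j\<in>out_nbrs E i. W $ i $ j)"

definition max_weight :: "('n::finite \<times> 'n) set \<Rightarrow> real^'n^'n \<Rightarrow> 'n \<Rightarrow> real" where
  "max_weight E W i = Max ((\<lambda>j. W $ i $ j) ` out_nbrs E i)"

definition weight_balanced :: "('n::finite \<times> 'n) set \<Rightarrow> real^'n^'n \<Rightarrow> bool" where
  "weight_balanced E W \<longleftrightarrow>
     (\<forall>i. (\<Sum>j\<in>out_nbrs E i. W $ i $ j) = (\<Sum>j\<in>in_nbrs E i. W $ j $ i))"

definition strongly_connected :: "('n \<times> 'n) set \<Rightarrow> bool" where
  "strongly_connected E \<longleftrightarrow> (\<forall>i j. i \<noteq> j \<longrightarrow> (i, j) \<in> E\<^sup>+)"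


section \<open>Design parameters, trigger function and control law\<close>

text \<open>The bound on \<open>\<epsilon> i\<close> involves the maximum over the out-neighbors and is therefore imposed only if
  there are any.  In a strongly connected digraph this matters only for a single agent without a
  loop.\<close>

definition design_parameters ::
  "('n::finite \<times> 'n) set \<Rightarrow> real^'n^'n \<Rightarrow> ('n \<Rightarrow> real) \<Rightarrow> ('n \<Rightarrow> real) \<Rightarrow> bool" where
  "design_parameters E W \<sigma> \<epsilon> \<longleftrightarrow>
     (\<forall>i. 0 < \<sigma> i \<and> \<sigma> i < 1 \<and> 0 < \<epsilon> i \<and>
       (out_nbrs E i \<noteq> {} \<longrightarrow>
         \<epsilon> i < sqrt (\<sigma> i / (4 * out_degree E W i * max_weight E W i * real (card (out_nbrs E i))))))"

text \<open>In the following, \<open>h\<close> is the vector of the last broadcast states (x-hat) and \<open>e\<close> the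
  vector of the errors \<open>h - x\<close>.\<close>

definition phi :: "('n::finite \<times> 'n) set \<Rightarrow> real^'n^'n \<Rightarrow> real^'n \<Rightarrow> 'n \<Rightarrow> real" where
  "phi E W h i = (\<Sum>j\<in>out_nbrs E i. W $ i $ j * (h $ i - h $ j)\<^sup>2)"

definition trigger_fn ::
  "('n::finite \<times> 'n) set \<Rightarrow> real^'n^'n \<Rightarrow> ('n \<Rightarrow> real) \<Rightarrow> real^'n \<Rightarrow> real^'n \<Rightarrow> 'n \<Rightarrow> real" where
  "trigger_fn E W \<sigma> h e i = (e $ i)\<^sup>2 - \<sigma> i / (4 * out_degree E W i) * phi E W h i"

definition control :: "('n::finite \<times> 'n) set \<Rightarrow> real^'n^'n \<Rightarrow> real^'n \<Rightarrow> 'n \<Rightarrow> real" where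
  "control E W h i = - (\<Sum>j\<in>out_nbrs E i. W $ i $ j * (h $ i - h $ j))"


section \<open>Broadcast histories\<close>

text \<open>A broadcast history is a function \<open>S\<close>, where \<open>S t\<close> is the set of the agents that broadcast
  at time \<open>t \<ge> 0\<close>.  The initial memory is left arbitrary: \<open>h0 $ i\<close> is the state of agent \<open>i\<close> that
  is known to its in-neighbors when the evolution starts, and \<open>T0 i \<le> 0\<close> is the time of the
  corresponding broadcast.  An initial broadcast by every agent is the case \<open>h0 = x 0\<close>,
  \<open>T0 i = 0\<close>.\<close>

definition earlier_broadcasts :: "(real \<Rightarrow> 'n set) \<Rightarrow> real \<Rightarrow> 'n \<Rightarrow> real set" where
  "earlier_broadcasts S t i = {s. 0 \<le> s \<and> s < t \<and> i \<in> S s}"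

text \<open>If the broadcasts of \<open>i\<close> before \<open>t\<close> have a last one, the supremum below is attained and is
  the time of that broadcast.  Finitely many broadcasts in bounded time are not presupposed: should
  broadcasts accumulate at \<open>t\<close>, the supremum is \<open>t\<close> itself, and \<open>held_before\<close> is the left limit
  of the broadcast states of \<open>i\<close>.\<close>

definition last_before :: "(real \<Rightarrow> 'n set) \<Rightarrow> ('n \<Rightarrow> real) \<Rightarrow> real \<Rightarrow> 'n \<Rightarrow> real" where
  "last_before S T0 t i =
     (if earlier_broadcasts S t i = {} then T0 i else Sup (earlier_broadcasts S t i))"

definition held_before ::
  "(real \<Rightarrow> real^'n::finite) \<Rightarrow> (real \<Rightarrow> 'n set) \<Rightarrow> real^'n \<Rightarrow> real \<Rightarrow> real^'n" where
  "held_before x S h0 t =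
     (\<chi> i. if earlier_broadcasts S t i = {} then h0 $ i else x (Sup (earlier_broadcasts S t i)) $ i)"

text \<open>Last broadcast times and states at time \<open>t\<close> once the agents in \<open>A\<close> have broadcast at
  time \<open>t\<close>.\<close>

definition last_broadcast ::
  "(real \<Rightarrow> 'n set) \<Rightarrow> ('n \<Rightarrow> real) \<Rightarrow> real \<Rightarrow> 'n set \<Rightarrow> 'n \<Rightarrow> real" where
  "last_broadcast S T0 t A i = (if i \<in> A then t else last_before S T0 t i)"

definition held ::
  "(real \<Rightarrow> real^'n::finite) \<Rightarrow> (real \<Rightarrow> 'n set) \<Rightarrow> real^'n \<Rightarrow> real \<Rightarrow> 'n set \<Rightarrow> real^'n" where
  "held x S h0 t A = (\<chi> i. if i \<in> A then x t $ i else held_before x S h0 t $ i)"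

definition xhat ::
  "(real \<Rightarrow> real^'n::finite) \<Rightarrow> (real \<Rightarrow> 'n set) \<Rightarrow> real^'n \<Rightarrow> real \<Rightarrow> real^'n" where
  "xhat x S h0 t = held x S h0 t (S t)"


section \<open>The event-triggered communication and control law\<close>

text \<open>The two rules of the law, evaluated at time \<open>t\<close> when the agents in \<open>A\<close> have already broadcast
  at time \<open>t\<close> (and these broadcasts have been received).\<close>

definition rule1 ::
  "('n::finite \<times> 'n) set \<Rightarrow> real^'n^'n \<Rightarrow> ('n \<Rightarrow> real) \<Rightarrow> (real \<Rightarrow> real^'n) \<Rightarrow> (real \<Rightarrow> 'n set) \<Rightarrow>
   real^'n \<Rightarrow> real \<Rightarrow> 'n set \<Rightarrow> 'n \<Rightarrow> bool" where
  "rule1 E W \<sigma> x S h0 t A i \<longleftrightarrow>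
     (let h = held x S h0 t A; f = trigger_fn E W \<sigma> h (h - x t) i
      in f > 0 \<or> (f = 0 \<and> phi E W h i \<noteq> 0))"

definition rule2 ::
  "('n \<times> 'n) set \<Rightarrow> ('n \<Rightarrow> real) \<Rightarrow> (real \<Rightarrow> 'n set) \<Rightarrow> ('n \<Rightarrow> real) \<Rightarrow>
   real \<Rightarrow> 'n set \<Rightarrow> 'n \<Rightarrow> bool" where
  "rule2 E \<epsilon> S T0 t A i \<longleftrightarrow>
     out_nbrs E i \<inter> A \<noteq> {} \<and>
     t \<in> {last_broadcast S T0 t A i <..< last_broadcast S T0 t A i + \<epsilon> i}"

definition triggered ::
  "('n::finite \<times> 'n) set \<Rightarrow> real^'n^'n \<Rightarrow> ('n \<Rightarrow> real) \<Rightarrow> ('n \<Rightarrow> real) \<Rightarrow> (real \<Rightarrow> real^'n) \<Rightarrow>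
   (real \<Rightarrow> 'n set) \<Rightarrow> real^'n \<Rightarrow> ('n \<Rightarrow> real) \<Rightarrow> real \<Rightarrow> 'n set \<Rightarrow> 'n set" where
  "triggered E W \<sigma> \<epsilon> x S h0 T0 t A = {i. rule1 E W \<sigma> x S h0 t A i \<or> rule2 E \<epsilon> S T0 t A i}"

text \<open>A broadcast is received instantaneously and can therefore trigger further broadcasts at the
  same time instant.  \<open>cascade\<close> describes the sets of agents that can have broadcast after some
  rounds at time \<open>t\<close>; in each round some of the currently triggered agents broadcast, so that
  every order of (or simultaneity among) the broadcasts at one instant is covered.\<close>

inductive cascade ::
  "('n::finite \<times> 'n) set \<Rightarrow> real^'n^'n \<Rightarrow> ('n \<Rightarrow> real) \<Rightarrow> ('n \<Rightarrow> real) \<Rightarrow> (real \<Rightarrow> real^'n) \<Rightarrow>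
   (real \<Rightarrow> 'n set) \<Rightarrow> real^'n \<Rightarrow> ('n \<Rightarrow> real) \<Rightarrow> real \<Rightarrow> 'n set \<Rightarrow> bool"
  for E W \<sigma> \<epsilon> x S h0 T0 t where
  start: "cascade E W \<sigma> \<epsilon> x S h0 T0 t {}"
| round: "cascade E W \<sigma> \<epsilon> x S h0 T0 t A \<Longrightarrow> D \<subseteq> triggered E W \<sigma> \<epsilon> x S h0 T0 t A \<Longrightarrow>
    cascade E W \<sigma> \<epsilon> x S h0 T0 t (A \<union> D)"

text \<open>The agents broadcasting at time \<open>t\<close> form a cascade that has run to completion.  As \<open>xhat\<close>
  is updated at the instants of broadcasts, the control signal is discontinuous there, and the
  equation "derivative of \<open>x\<close> equals \<open>u\<close>" is to be read with the right derivative.\<close>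

definition event_triggered_execution ::
  "('n::finite \<times> 'n) set \<Rightarrow> real^'n^'n \<Rightarrow> ('n \<Rightarrow> real) \<Rightarrow> ('n \<Rightarrow> real) \<Rightarrow> (real \<Rightarrow> real^'n) \<Rightarrow>
   (real \<Rightarrow> 'n set) \<Rightarrow> real^'n \<Rightarrow> ('n \<Rightarrow> real) \<Rightarrow> bool" where
  "event_triggered_execution E W \<sigma> \<epsilon> x S h0 T0 \<longleftrightarrow>
     (\<forall>i. T0 i \<le> 0) \<and>
     continuous_on {0..} x \<and>
     (\<forall>t\<ge>0. \<forall>i. ((\<lambda>s. x s $ i) has_real_derivative control E W (xhat x S h0 t) i) (at_right t)) \<and>
     (\<forall>t\<ge>0. cascade E W \<sigma> \<epsilon> x S h0 T0 t (S t) \<and> triggered E W \<sigma> \<epsilon> x S h0 T0 t (S t) = {})"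


section \<open>Average and exponential convergence\<close>

definition average_state :: "real^'n::finite \<Rightarrow> real^'n" where
  "average_state v = (1 / real CARD('n) * (1 \<bullet> v)) *\<^sub>R 1"

definition exponentially_converges :: "(real \<Rightarrow> real^'n::finite) \<Rightarrow> real^'n \<Rightarrow> bool" where
  "exponentially_converges x l \<longleftrightarrow>
     (\<exists>c>0. \<exists>\<alpha>>0. \<forall>t\<ge>0. norm (x t - l) \<le> c * exp (- \<alpha> * t))"

end

theory Submission
  imports Defs
begin

text \<open>Since the cascade at each instant runs to completion, \<open>f\<^sub>i(e\<^sub>i) \<le> 0\<close> holds at every time for the
  error after all broadcasts.  The sum of the states has right derivative zero by weight balance, so
  the average is invariant.  For \<open>V = \<parallel>x - m 1\<parallel>\<^sup>2\<close>, with \<open>m\<close> the average, writing \<open>x = h - e\<close> and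
  applying \<open>e (h\<^sub>i - h\<^sub>j) \<le> e\<^sup>2 + (h\<^sub>i - h\<^sub>j)\<^sup>2 / 4\<close> bounds the right derivative of \<open>V\<close> by
  \<open>- 1/2 \<Sum>\<^sub>i (1 - \<sigma>\<^sub>i) \<phi>\<^sub>i\<close>; strong connectivity bounds \<open>V\<close> by a multiple of \<open>\<Sum>\<^sub>i \<phi>\<^sub>i\<close>.
  A continuous function whose right derivative is nonpositive everywhere is nonincreasing,
  which yields the decay of \<open>V\<close> even if broadcasts were to accumulate in finite time.\<close>

section \<open>Monotonicity and decay from right derivatives\<close>

text \<open>Subtracting a slope \<delta> makes the right derivative strictly negative. The last time
  at which the tilted function is at most its initial value then cannot precede \<open>b\<close>,
  since the function still drops just after it. Finally \<delta> tends to 0.\<close>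

lemma right_derivative_nonpos_imp_le:
  fixes f f' :: "real \<Rightarrow> real"
  assumes "a \<le> b" and cont: "continuous_on {a..b} f"
    and der: "\<And>t. a \<le> t \<Longrightarrow> t < b \<Longrightarrow> (f has_real_derivative f' t) (at_right t)"
    and nonpos: "\<And>t. a \<le> t \<Longrightarrow> t < b \<Longrightarrow> f' t \<le> 0"
  shows "f b \<le> f a"
proof -
  have tilted: "f b - \<delta> * b \<le> f a - \<delta> * a" if "\<delta> > 0" for \<delta>
  proof (rule ccontr)
    assume contra: "\<not> ?thesis"
    define g where "g t = f t - \<delta> * t" for t
    define K where "K = {t \<in> {a..b}. g t \<le> g a}"
    have "continuous_on {a..b} g"
      unfolding g_def by (intro continuous_intros cont)
    then have "closedin (top_of_set {a..b}) K"
      using continuous_closedin_preimage[of "{a..b}" g "{..g a}"]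
      by (simp add: K_def vimage_def Int_def)
    then have "compact K"
      using closedin_compact compact_Icc by blast
    moreover have "a \<in> K"
      using \<open>a \<le> b\<close> by (simp add: K_def)
    ultimately obtain c where c: "c \<in> K" and cmax: "\<And>t. t \<in> K \<Longrightarrow> t \<le> c"
      using compact_attains_sup[of K] by blast
    have "c < b"
      using c contra by (cases "c = b") (auto simp: K_def g_def)
    have "a \<le> c" "g c \<le> g a"
      using c by (auto simp: K_def)
    have "(g has_real_derivative f' c - \<delta>) (at_right c)"
      unfolding g_def using der[OF \<open>a \<le> c\<close> \<open>c < b\<close>]
      by (auto intro!: derivative_eq_intros)
    moreover have "f' c - \<delta> < 0"
      using nonpos[OF \<open>a \<le> c\<close> \<open>c < b\<close>] \<open>\<delta> > 0\<close> by simp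
    ultimately obtain d where "d > 0"
      and dec: "\<And>h. h > 0 \<Longrightarrow> c + h \<in> {c<..} \<Longrightarrow> h < d \<Longrightarrow> g (c + h) < g c"
      using has_real_derivative_neg_dec_right by blast
    \<comment> \<open>A step short enough for the local decrease at \<open>c\<close> and for staying
      in \<open>{a..b}\<close>; it lands in \<open>K\<close> beyond its maximum
      \<open>c\<close>.\<close>
    define h where "h = min (d / 2) (b - c)"
    have h: "h > 0" "h < d" "c + h \<le> b"
      using \<open>d > 0\<close> \<open>c < b\<close> by (auto simp: h_def)
    have "c + h \<in> K"
      using dec[of h] h \<open>a \<le> c\<close> \<open>g c \<le> g a\<close> by (auto simp: K_def)
    with cmax h show False by fastforce
  qed
  show ?thesis
  proof (rule field_le_epsilon)
    fix e :: real assume "e > 0"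
    \<comment> \<open>The \<open>+ 1\<close> keeps the denominator positive when
      \<open>a = b\<close>.\<close>
    define \<delta> where "\<delta> = e / (b - a + 1)"
    have "\<delta> > 0" "\<delta> * (b - a) \<le> e"
      using \<open>e > 0\<close> \<open>a \<le> b\<close> by (auto simp: \<delta>_def field_simps)
    with tilted[of \<delta>] show "f b \<le> f a + e"
      by (simp add: algebra_simps)
  qed
qed

text \<open>Gronwall argument: with the integrating factor \<open>exp (\<beta> * s)\<close>, the
  product has right derivative \<open>exp (\<beta> * s) * (V' s + \<beta> * V s)\<close>, which is
  nonpositive.\<close>

lemma right_derivative_exp_decay:
  fixes V V' :: "real \<Rightarrow> real"
  assumes cont: "continuous_on {0..} V"
    and der: "\<And>t. t \<ge> 0 \<Longrightarrow> (V has_real_derivative V' t) (at_right t)"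
    and le: "\<And>t. t \<ge> 0 \<Longrightarrow> V' t \<le> - \<beta> * V t"
    and "t \<ge> 0"
  shows "V t \<le> V 0 * exp (- \<beta> * t)"
proof -
  have "V t * exp (\<beta> * t) \<le> V 0 * exp (\<beta> * 0)"
  proof (rule right_derivative_nonpos_imp_le
      [where f = "\<lambda>s. V s * exp (\<beta> * s)" and a = 0 and b = t and f' = "\<lambda>s. V' s * exp (\<beta> * s) + exp (\<beta> * s) * \<beta> * V s"])
    show "continuous_on {0..t} (\<lambda>s. V s * exp (\<beta> * s))"
      by (intro continuous_intros continuous_on_subset[OF cont]) auto
  next
    fix s :: real assume s: "0 \<le> s" "s < t"
    show "((\<lambda>s. V s * exp (\<beta> * s)) has_real_derivative
        V' s * exp (\<beta> * s) + exp (\<beta> * s) * \<beta> * V s) (at_right s)"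
      using der[OF s(1)] by (auto intro!: derivative_eq_intros)
    have "exp (\<beta> * s) * (V' s + \<beta> * V s) \<le> 0"
      using le[OF s(1)] by (intro mult_nonneg_nonpos) auto
    then show "V' s * exp (\<beta> * s) + exp (\<beta> * s) * \<beta> * V s \<le> 0"
      by (simp add: algebra_simps)
  qed (use \<open>t \<ge> 0\<close> in auto)
  then show ?thesis
    by (simp add: exp_minus field_simps)
qed

lemma exponentially_converges_imp_tendsto:
  assumes "exponentially_converges x l"
  shows "(x \<longlongrightarrow> l) at_top"
proof -
  obtain c \<alpha> where "\<alpha> > 0" and bound: "\<And>t. t \<ge> 0 \<Longrightarrow> norm (x t - l) \<le> c * exp (- \<alpha> * t)"
    using assms unfolding exponentially_converges_def by blast
  have "filterlim (\<lambda>t. \<alpha> * t) at_top at_top"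
    using \<open>\<alpha> > 0\<close> by (intro filterlim_tendsto_pos_mult_at_top[OF tendsto_const] filterlim_ident)
  then have "((\<lambda>t. exp (- (\<alpha> * t))) \<longlongrightarrow> 0) at_top"
    by (intro filterlim_compose[OF exp_at_bot] filterlim_compose[OF filterlim_uminus_at_bot_at_top])
  then have "((\<lambda>t. c * exp (- \<alpha> * t)) \<longlongrightarrow> 0) at_top"
    using tendsto_mult_right_zero by fastforce
  then have "((\<lambda>t. x t - l) \<longlongrightarrow> 0) at_top"
    by (rule Lim_null_comparison[rotated])
      (use bound in \<open>auto intro: eventually_mono[OF eventually_ge_at_top[of 0]]\<close>)
  then show ?thesis
    using Lim_null by blast
qed

section \<open>Weight balance and the quadratic form of the control\<close>

text \<open>Weights vanish off the edges. Summing over all vertices makes it possible to exchange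
  the order in double sums.\<close>

lemma sum_out_nbrs:
  assumes "weighted_digraph E W"
  shows "(\<Sum>j\<in>out_nbrs E i. W $ i $ j * g j) = (\<Sum>j\<in>UNIV. W $ i $ j * g j)"
  using assms by (intro sum.mono_neutral_left) (auto simp: weighted_digraph_def out_nbrs_def)

lemma sum_in_nbrs:
  assumes "weighted_digraph E W"
  shows "(\<Sum>j\<in>in_nbrs E i. W $ j $ i * g j) = (\<Sum>j\<in>UNIV. W $ j $ i * g j)"
  using assms by (intro sum.mono_neutral_left) (auto simp: weighted_digraph_def in_nbrs_def)

lemma weighted_digraph_nonneg:
  assumes "weighted_digraph E W"
  shows "W $ i $ j \<ge> 0"
  using assms unfolding weighted_digraph_def by (cases "(i, j) \<in> E") (auto simp: less_imp_le)

text \<open>Weight balance says that row sums and column sums of \<open>W\<close> agree; exchanging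
  the two sums turns one side into the other.\<close>

lemma weight_balanced_sum:
  assumes "weighted_digraph E W" "weight_balanced E W"
  shows "(\<Sum>i\<in>UNIV. \<Sum>j\<in>UNIV. W $ i $ j * g j) = (\<Sum>i\<in>UNIV. \<Sum>j\<in>UNIV. W $ i $ j * g i)"
proof -
  have "(\<Sum>j\<in>UNIV. W $ j $ i) = (\<Sum>j\<in>UNIV. W $ i $ j)" for i
    using assms(2) sum_out_nbrs[OF assms(1), of i "\<lambda>_. 1"] sum_in_nbrs[OF assms(1), of i "\<lambda>_. 1"]
    by (simp add: weight_balanced_def)
  then show ?thesis
    by (subst sum.swap) (simp flip: sum_distrib_right)
qed

lemma sum_control_eq_0:
  assumes "weighted_digraph E W" "weight_balanced E W"
  shows "(\<Sum>i\<in>UNIV. control E W h i) = 0"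
  using weight_balanced_sum[OF assms, of "\<lambda>i. h $ i"]
  by (simp add: control_def sum_out_nbrs[OF assms(1)] sum_negf right_diff_distrib sum_subtractf)

text \<open>As \<open>control\<close> is minus the graph Laplacian applied to \<open>h\<close>, this
  computes its quadratic form. Termwise, \<open>(a - b)^2 - 2 * a * (a - b) = b^2 - a^2\<close>, and
  the weighted sum of these differences vanishes by balance.\<close>

lemma sum_mult_control:
  assumes "weighted_digraph E W" "weight_balanced E W"
  shows "(\<Sum>i\<in>UNIV. h $ i * control E W h i) = - (\<Sum>i\<in>UNIV. phi E W h i) / 2"
proof -
  have "(\<Sum>i\<in>UNIV. phi E W h i) + 2 * (\<Sum>i\<in>UNIV. h $ i * control E W h i)
      = (\<Sum>i\<in>UNIV. \<Sum>j\<in>UNIV. W $ i $ j * (h $ i - h $ j)\<^sup>2 - 2 * h $ i * (W $ i $ j * (h $ i - h $ j)))"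
    by (simp add: phi_def control_def sum_out_nbrs[OF assms(1)] sum_negf sum_subtractf
        sum_distrib_left mult.assoc)
  also have "\<dots> = (\<Sum>i\<in>UNIV. \<Sum>j\<in>UNIV. W $ i $ j * (h $ j)\<^sup>2 - W $ i $ j * (h $ i)\<^sup>2)"
    by (intro sum.cong refl) (simp add: power2_eq_square algebra_simps)
  also have "\<dots> = 0"
    using weight_balanced_sum[OF assms, of "\<lambda>i. (h $ i)\<^sup>2"] by (simp add: sum_subtractf)
  finally show ?thesis by simp
qed

section \<open>Differences of broadcast states bounded by \<open>phi\<close>\<close>

lemma phi_nonneg:
  assumes "weighted_digraph E W"
  shows "phi E W h i \<ge> 0"
  unfolding phi_def by (intro sum_nonneg mult_nonneg_nonneg weighted_digraph_nonneg[OF assms]) auto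

lemma phi_le_sum_phi:
  assumes "weighted_digraph E W"
  shows "phi E W h i \<le> (\<Sum>k\<in>UNIV. phi E W h k)"
  by (rule member_le_sum) (auto intro: phi_nonneg[OF assms])

lemma edge_diff_le_phi:
  assumes "weighted_digraph E W" "(i, j) \<in> E"
  shows "(h $ i - h $ j)\<^sup>2 \<le> inverse (W $ i $ j) * (\<Sum>k\<in>UNIV. phi E W h k)"
proof -
  have "W $ i $ j * (h $ i - h $ j)\<^sup>2 \<le> phi E W h i"
    unfolding phi_def using assms weighted_digraph_nonneg[OF assms(1)]
    by (intro member_le_sum[of j _ "\<lambda>j. W $ i $ j * (h $ i - h $ j)\<^sup>2"]) (auto simp: out_nbrs_def)
  also note phi_le_sum_phi[OF assms(1)]
  finally show ?thesis
    using assms by (simp add: weighted_digraph_def field_simps)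
qed

text \<open>Edge bounds are chained along the path by
  \<open>(a + b)^2 \<le> 2 * a^2 + 2 * b^2\<close>. The constant depends on the path and the weights
  but not on \<open>h\<close>, hence the order of quantifiers.\<close>

lemma path_diff_le_phi:
  assumes "weighted_digraph E W" "(i, j) \<in> E\<^sup>+"
  shows "\<exists>C\<ge>0. \<forall>h. (h $ i - h $ j)\<^sup>2 \<le> C * (\<Sum>k\<in>UNIV. phi E W h k)"
  using assms(2)
proof (induction rule: trancl_induct)
  case (base j)
  show ?case
    using edge_diff_le_phi[OF assms(1) base] weighted_digraph_nonneg[OF assms(1), of i j]
    by (intro exI[of _ "inverse (W $ i $ j)"]) auto
next
  case (step j k)
  then obtain C where C: "C \<ge> 0" "\<And>h. (h $ i - h $ j)\<^sup>2 \<le> C * (\<Sum>k\<in>UNIV. phi E W h k)"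
    by blast
  have "(h $ i - h $ k)\<^sup>2 \<le> (2 * C + 2 * inverse (W $ j $ k)) * (\<Sum>k\<in>UNIV. phi E W h k)" for h
  proof -
    have "(h $ i - h $ k)\<^sup>2 \<le> 2 * (h $ i - h $ j)\<^sup>2 + 2 * (h $ j - h $ k)\<^sup>2"
      using sum_squares_bound[of "h $ i - h $ j" "h $ j - h $ k"]
      by (simp add: power2_eq_square algebra_simps)
    then show ?thesis
      using C(2)[of h] edge_diff_le_phi[OF assms(1) step(2), of h] by (simp add: algebra_simps)
  qed
  then show ?case
    using C(1) weighted_digraph_nonneg[OF assms(1), of j k]
    by (intro exI[of _ "2 * C + 2 * inverse (W $ j $ k)"]) auto
qed

lemma strongly_connected_diff_le_phi:
  assumes "weighted_digraph E W" "strongly_connected E"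
  shows "\<exists>C\<ge>0. \<forall>h. (h $ i - h $ j)\<^sup>2 \<le> C * (\<Sum>k\<in>UNIV. phi E W h k)"
proof (cases "i = j")
  case False
  then show ?thesis
    using assms path_diff_le_phi[OF assms(1)] by (auto simp: strongly_connected_def)
qed auto

section \<open>Consequences of the trigger inequality\<close>

lemma trigger_fn_nonpos_iff:
  "trigger_fn E W \<sigma> h e i \<le> 0 \<longleftrightarrow> (e $ i)\<^sup>2 \<le> \<sigma> i / (4 * out_degree E W i) * phi E W h i"
  by (simp add: trigger_fn_def)

lemma execution_trigger_fn_nonpos:
  assumes "event_triggered_execution E W \<sigma> \<epsilon> x S h0 T0" "t \<ge> 0"
  shows "trigger_fn E W \<sigma> (xhat x S h0 t) (xhat x S h0 t - x t) i \<le> 0"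
proof -
  have "\<not> rule1 E W \<sigma> x S h0 t (S t) i"
    using assms unfolding event_triggered_execution_def triggered_def by blast
  then show ?thesis
    by (auto simp: rule1_def Let_def xhat_def)
qed

text \<open>The termwise bound sums to \<open>out_degree * e^2 + phi / 4\<close>. The trigger
  threshold has \<open>4 * out_degree\<close> in its denominator precisely so that the first summand
  is at most \<open>\<sigma> / 4 * phi\<close>.\<close>

lemma error_mult_control_le:
  assumes "weighted_digraph E W" "trigger_fn E W \<sigma> h e i \<le> 0" "\<sigma> i > 0"
  shows "- (e $ i * control E W h i) \<le> (\<sigma> i + 1) / 4 * phi E W h i"
proof -
  let ?d = "out_degree E W i"
  have d: "?d = (\<Sum>j\<in>UNIV. W $ i $ j)" "?d \<ge> 0"
    using sum_out_nbrs[OF assms(1), of i "\<lambda>_. 1"] weighted_digraph_nonneg[OF assms(1)]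
    by (auto simp: out_degree_def intro: sum_nonneg)
  have "- (e $ i * control E W h i) = (\<Sum>j\<in>UNIV. W $ i $ j * (e $ i * (h $ i - h $ j)))"
    by (simp add: control_def sum_out_nbrs[OF assms(1)] sum_distrib_left mult.left_commute)
  also have "\<dots> \<le> (\<Sum>j\<in>UNIV. W $ i $ j * ((e $ i)\<^sup>2 + (h $ i - h $ j)\<^sup>2 / 4))"
  proof (intro sum_mono mult_left_mono weighted_digraph_nonneg[OF assms(1)])
    fix j
    show "e $ i * (h $ i - h $ j) \<le> (e $ i)\<^sup>2 + (h $ i - h $ j)\<^sup>2 / 4"
      using sum_squares_bound[of "e $ i" "(h $ i - h $ j) / 2"] by (simp add: power_divide)
  qed
  also have "\<dots> = ?d * (e $ i)\<^sup>2 + phi E W h i / 4"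
    by (simp add: d phi_def sum_out_nbrs[OF assms(1)] distrib_left sum.distrib
        sum_distrib_right sum_divide_distrib)
  also have "?d * (e $ i)\<^sup>2 \<le> \<sigma> i / 4 * phi E W h i"
  \<comment> \<open>The out-degree can be cancelled only if it is nonzero; otherwise the left side
    is 0 and the right side nonnegative.\<close>
  proof (cases "?d = 0")
    case True
    then show ?thesis
      using phi_nonneg[OF assms(1)] assms(3) by simp
  next
    case False
    have "?d * (e $ i)\<^sup>2 \<le> ?d * (\<sigma> i / (4 * ?d) * phi E W h i)"
      using assms(2) d(2) by (intro mult_left_mono) (simp_all add: trigger_fn_nonpos_iff)
    also have "\<dots> = \<sigma> i / 4 * phi E W h i"
      using False by simp
    finally show ?thesis .
  qed
  finally show ?thesis
    by (simp add: algebra_simps add_divide_distrib)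
qed

text \<open>The left side is the derivative of the squared disagreement when \<open>y\<close> moves
  with velocity \<open>control\<close>. Splitting \<open>y - m\<close> into \<open>h\<close>, the
  error and \<open>m\<close>, the first part gives \<open>- phi\<close>, the second at most
  \<open>(\<sigma> + 1) / 2 * phi\<close>, and the third vanishes because the controls sum to
  0.\<close>

lemma disagreement_decrease:
  assumes "weighted_digraph E W" "weight_balanced E W"
    and "\<And>i. trigger_fn E W \<sigma> h (h - y) i \<le> 0" "\<And>i. \<sigma> i > 0"
  shows "(\<Sum>i\<in>UNIV. 2 * (y $ i - m) * control E W h i) \<le> - (\<Sum>i\<in>UNIV. (1 - \<sigma> i) * phi E W h i) / 2"
proof -
  have "(\<Sum>i\<in>UNIV. 2 * (y $ i - m) * control E W h i) =
     2 * (\<Sum>i\<in>UNIV. h $ i * control E W h i)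
     + 2 * (\<Sum>i\<in>UNIV. - ((h - y) $ i * control E W h i))
     - 2 * m * (\<Sum>i\<in>UNIV. control E W h i)"
    by (simp add: sum_distrib_left flip: sum.distrib sum_subtractf)
      (simp add: algebra_simps)
  also have "\<dots> \<le> - (\<Sum>i\<in>UNIV. phi E W h i) + 2 * (\<Sum>i\<in>UNIV. (\<sigma> i + 1) / 4 * phi E W h i)"
    using sum_mono[of UNIV, OF error_mult_control_le[OF assms(1) assms(3) assms(4)]]
    by (simp add: sum_control_eq_0[OF assms(1,2)] sum_mult_control[OF assms(1,2)])
  also have "\<dots> = - (\<Sum>i\<in>UNIV. (1 - \<sigma> i) * phi E W h i) / 2"
    unfolding sum_distrib_left sum_divide_distrib sum.distrib[symmetric] sum_negf[symmetric]
    by (intro sum.cong refl) (simp add: field_simps)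
  finally show ?thesis .
qed

text \<open>All broadcast states lie close to that of one reference vertex \<open>k\<close>, and the
  trigger keeps each \<open>y $ i\<close> close to \<open>h $ i\<close>. Passing from
  \<open>h $ k\<close> to the mean \<open>m\<close> only lowers the sum of squares.\<close>

lemma disagreement_le_phi:
  fixes W :: "real^'n::finite^'n"
  assumes "weighted_digraph E W" "strongly_connected E" "\<And>i. \<sigma> i > 0"
  shows "\<exists>C>0. \<forall>h y m. (\<forall>i. trigger_fn E W \<sigma> h (h - y) i \<le> 0) \<longrightarrow> (\<Sum>i\<in>UNIV. y $ i - m) = 0 \<longrightarrow>
      (\<Sum>i\<in>UNIV. (y $ i - m)\<^sup>2) \<le> C * (\<Sum>i\<in>UNIV. phi E W h i)"
proof -
  \<comment> \<open>Any vertex serves as reference.\<close>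
  define k :: 'n where "k = undefined"
  obtain D where D: "\<And>i. D i \<ge> 0"
      "\<And>i h. (h $ i - h $ k)\<^sup>2 \<le> D i * (\<Sum>l\<in>UNIV. phi E W h l)"
    using strongly_connected_diff_le_phi[OF assms(1,2), of _ k] that by metis
  define B where "B i = \<sigma> i / (4 * out_degree E W i)" for i
  have B: "B i \<ge> 0" for i
    using assms(3)[of i] weighted_digraph_nonneg[OF assms(1)]
    by (auto simp: B_def out_degree_def intro!: divide_nonneg_nonneg sum_nonneg)
  \<comment> \<open>The \<open>+ 1\<close> makes \<open>C\<close> strictly positive, so that it can
    later be divided by.\<close>
  define C where "C = (\<Sum>i\<in>UNIV. 2 * D i + 2 * B i) + 1"
  have "(\<Sum>i\<in>UNIV. 2 * D i + 2 * B i) \<ge> 0"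
    using D(1) B by (intro sum_nonneg) simp
  then have "C > 0"
    by (simp add: C_def)
  moreover have "(\<Sum>i\<in>UNIV. (y $ i - m)\<^sup>2) \<le> C * (\<Sum>i\<in>UNIV. phi E W h i)"
    if tr: "\<And>i. trigger_fn E W \<sigma> h (h - y) i \<le> 0" and mean: "(\<Sum>i\<in>UNIV. y $ i - m) = 0" for h y m
  proof -
    let ?\<Phi> = "\<Sum>i\<in>UNIV. phi E W h i"
    have "?\<Phi> \<ge> 0"
      by (intro sum_nonneg phi_nonneg[OF assms(1)])
    \<comment> \<open>Steiner's identity: the cross term vanishes since the deviations from
      \<open>m\<close> sum to 0.\<close>
    have "(\<Sum>i\<in>UNIV. (y $ i - m)\<^sup>2) =
        (\<Sum>i\<in>UNIV. (y $ i - h $ k)\<^sup>2) + 2 * (h $ k - m) * (\<Sum>i\<in>UNIV. y $ i - m)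
        - (\<Sum>i\<in>(UNIV :: 'n set). (h $ k - m)\<^sup>2)"
      unfolding sum_distrib_left sum.distrib[symmetric] sum_subtractf[symmetric]
      by (intro sum.cong refl) (simp add: power2_eq_square algebra_simps)
    also have "\<dots> \<le> (\<Sum>i\<in>UNIV. (y $ i - h $ k)\<^sup>2)"
      by (simp only: mean) (simp add: sum_nonneg)
    also have "\<dots> \<le> (\<Sum>i\<in>UNIV. (2 * D i + 2 * B i) * ?\<Phi>)"
    proof (rule sum_mono)
      fix i
      \<comment> \<open>This is \<open>(a - b)^2 \<le> 2 * a^2 + 2 * b^2\<close>, equivalent to
        \<open>(a + b)^2 \<ge> 0\<close>.\<close>
      have "(y $ i - h $ k)\<^sup>2 \<le> 2 * (h $ i - h $ k)\<^sup>2 + 2 * ((h - y) $ i)\<^sup>2"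
        using zero_le_power2[of "(h $ i - h $ k) + (h $ i - y $ i)"]
        by (simp add: power2_eq_square algebra_simps)
      also have "((h - y) $ i)\<^sup>2 \<le> B i * phi E W h i"
        using tr[of i] by (simp only: trigger_fn_nonpos_iff B_def)
      also have "\<dots> \<le> B i * ?\<Phi>"
        by (intro mult_left_mono phi_le_sum_phi[OF assms(1)] B)
      also note D(2)[of h i]
      finally show "(y $ i - h $ k)\<^sup>2 \<le> (2 * D i + 2 * B i) * ?\<Phi>"
        by (simp add: algebra_simps)
    qed
    also have "\<dots> \<le> C * ?\<Phi>"
      unfolding sum_distrib_right[symmetric] C_def
      using \<open>?\<Phi> \<ge> 0\<close> by (intro mult_right_mono) auto
    finally show ?thesis .
  qed
  ultimately show ?thesis by blast
qed

section \<open>Invariance of the average and exponential convergence\<close>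

text \<open>The right derivative of the sum is 0, so monotonicity applies both to the sum and to its
  negative.\<close>

lemma execution_sum_constant:
  assumes "weighted_digraph E W" "weight_balanced E W"
    and "event_triggered_execution E W \<sigma> \<epsilon> x S h0 T0" "t \<ge> 0"
  shows "(\<Sum>i\<in>UNIV. x t $ i) = (\<Sum>i\<in>UNIV. x 0 $ i)"
proof -
  have cont: "continuous_on {0..t} (\<lambda>s. \<Sum>i\<in>UNIV. x s $ i)"
    using assms(3) unfolding event_triggered_execution_def
    by (intro continuous_intros) (auto elim: continuous_on_subset)
  have der: "((\<lambda>s. \<Sum>i\<in>UNIV. x s $ i) has_real_derivative 0) (at_right s)" if "s \<ge> 0" for s
  proof -
    have "((\<lambda>s. \<Sum>i\<in>UNIV. x s $ i) has_real_derivative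
        (\<Sum>i\<in>UNIV. control E W (xhat x S h0 s) i)) (at_right s)"
      using assms(3) that by (intro DERIV_sum) (simp add: event_triggered_execution_def)
    then show ?thesis
      by (simp add: sum_control_eq_0[OF assms(1,2)])
  qed
  have "(\<Sum>i\<in>UNIV. x t $ i) \<le> (\<Sum>i\<in>UNIV. x 0 $ i)"
    by (rule right_derivative_nonpos_imp_le[OF assms(4) cont, where f' = "\<lambda>_. 0"]) (auto intro: der)
  moreover have "- (\<Sum>i\<in>UNIV. x t $ i) \<le> - (\<Sum>i\<in>UNIV. x 0 $ i)"
    by (rule right_derivative_nonpos_imp_le[OF assms(4) continuous_on_minus[OF cont],
          where f' = "\<lambda>_. 0"])
      (auto dest: DERIV_minus[OF der])
  ultimately show ?thesis by simp
qed

theorem theorem5p3: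
  fixes E :: "('n::finite \<times> 'n) set" and W :: "real^'n^'n"
    and \<sigma> \<epsilon> :: "'n \<Rightarrow> real"
    and x :: "real \<Rightarrow> real^'n" and S :: "real \<Rightarrow> 'n set"
    and h0 :: "real^'n" and T0 :: "'n \<Rightarrow> real"
  assumes "weighted_digraph E W"
    and "weight_balanced E W"
    and "strongly_connected E"
    and "design_parameters E W \<sigma> \<epsilon>"
    and "event_triggered_execution E W \<sigma> \<epsilon> x S h0 T0"
  shows "(x \<longlongrightarrow> average_state (x 0)) at_top \<and>
         exponentially_converges x (average_state (x 0))"
proof -
  note exec = assms(5)
  have \<sigma>: "\<sigma> i > 0" "\<sigma> i < 1" for i
    using assms(4) by (auto simp: design_parameters_def)
  define m where "m = (\<Sum>i\<in>UNIV. x 0 $ i) / real CARD('n)"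
  have avg: "average_state (x 0) $ i = m" for i
    by (simp add: average_state_def m_def inner_vec_def)
  define h where "h t = xhat x S h0 t" for t
  have tr: "trigger_fn E W \<sigma> (h t) (h t - x t) i \<le> 0" if "t \<ge> 0" for t i
    using execution_trigger_fn_nonpos[OF exec that] by (simp add: h_def)
  have mean: "(\<Sum>i\<in>UNIV. x t $ i - m) = 0" if "t \<ge> 0" for t
    using execution_sum_constant[OF assms(1,2) exec that] by (simp add: sum_subtractf m_def)
  obtain C where "C > 0"
    and disagreement: "\<forall>h y m. (\<forall>i. trigger_fn E W \<sigma> h (h - y) i \<le> 0) \<longrightarrow>
      (\<Sum>i\<in>UNIV. y $ i - m) = 0 \<longrightarrow>
      (\<Sum>i\<in>UNIV. (y $ i - m)\<^sup>2) \<le> C * (\<Sum>i\<in>UNIV. phi E W h i)"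
    using disagreement_le_phi[of E W \<sigma>, OF assms(1,3) \<sigma>(1)] by blast
  have C: "(\<Sum>i\<in>UNIV. (x t $ i - m)\<^sup>2) \<le> C * (\<Sum>i\<in>UNIV. phi E W (h t) i)" if "t \<ge> 0" for t
    using disagreement tr[OF that] mean[OF that] by blast
  \<comment> \<open>A decrease factor common to all agents, positive because there are finitely
    many.\<close>
  define \<kappa> where "\<kappa> = Min (range (\<lambda>i. 1 - \<sigma> i))"
  have \<kappa>: "\<kappa> > 0" "\<kappa> \<le> 1 - \<sigma> i" for i
    using \<sigma>(2) by (auto simp: \<kappa>_def)
  \<comment> \<open>The estimates give \<open>V' \<le> - \<kappa> / (2 * C) * V\<close>. As
    \<open>V\<close> is the squared norm, the norm decays at half that rate.\<close>
  define \<alpha> where "\<alpha> = \<kappa> / (4 * C)"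
  have "\<alpha> > 0"
    using \<kappa>(1) \<open>C > 0\<close> by (simp add: \<alpha>_def)
  define V where "V t = (\<Sum>i\<in>UNIV. (x t $ i - m)\<^sup>2)" for t
  have V_norm: "V t = (norm (x t - average_state (x 0)))\<^sup>2" for t
    unfolding power2_norm_eq_inner inner_vec_def V_def by (simp add: avg power2_eq_square)
  define V' where "V' t = (\<Sum>i\<in>UNIV. 2 * (x t $ i - m) * control E W (h t) i)" for t
  have decay: "V t \<le> V 0 * exp (- (2 * \<alpha>) * t)" if "t \<ge> 0" for t
  proof (rule right_derivative_exp_decay[where V' = V', OF _ _ _ that])
    show "continuous_on {0..} V"
      using exec unfolding V_def event_triggered_execution_def by (intro continuous_intros) auto
  next
    fix t :: real assume "t \<ge> 0"
    then have "((\<lambda>s. x s $ i) has_real_derivative control E W (h t) i) (at_right t)" for i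
      using exec by (simp add: event_triggered_execution_def h_def)
    then have "((\<lambda>s. (x s $ i - m)\<^sup>2) has_real_derivative 2 * (x t $ i - m) * control E W (h t) i)
        (at_right t)" for i
      by (auto intro!: derivative_eq_intros)
    then show "(V has_real_derivative V' t) (at_right t)"
      unfolding V_def V'_def by (intro DERIV_sum)
    have \<kappa>_sum: "\<kappa> * (\<Sum>i\<in>UNIV. phi E W (h t) i) \<le> (\<Sum>i\<in>UNIV. (1 - \<sigma> i) * phi E W (h t) i)"
      unfolding sum_distrib_left
      by (intro sum_mono mult_right_mono \<kappa>(2) phi_nonneg[OF assms(1)])
    have "V' t \<le> - (\<Sum>i\<in>UNIV. (1 - \<sigma> i) * phi E W (h t) i) / 2"
      unfolding V'_def by (rule disagreement_decrease[OF assms(1,2) tr[OF \<open>t \<ge> 0\<close>] \<sigma>(1)])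
    also have "\<dots> \<le> - (\<kappa> / 2 * (\<Sum>i\<in>UNIV. phi E W (h t) i))"
      using \<kappa>_sum by simp
    also have "\<dots> \<le> - (\<kappa> / 2 * (V t / C))"
      using C[OF \<open>t \<ge> 0\<close>] \<open>C > 0\<close> \<kappa>(1)
      by (intro le_imp_neg_le mult_left_mono) (simp_all add: V_def field_simps)
    also have "\<dots> = - (2 * \<alpha>) * V t"
      by (simp add: \<alpha>_def)
    finally show "V' t \<le> - (2 * \<alpha>) * V t" .
  qed
  \<comment> \<open>The \<open>+ 1\<close> yields a positive constant even if all agents start at
    the average.\<close>
  have "norm (x t - average_state (x 0)) \<le> (norm (x 0 - average_state (x 0)) + 1) * exp (- \<alpha> * t)"
    if "t \<ge> 0" for t
  proof (rule power2_le_imp_le)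
    have "(norm (x t - average_state (x 0)))\<^sup>2
        \<le> (norm (x 0 - average_state (x 0)))\<^sup>2 * (exp (- \<alpha> * t))\<^sup>2"
      using decay[OF that] by (simp add: V_norm algebra_simps flip: exp_double)
    also have "\<dots> \<le> ((norm (x 0 - average_state (x 0)) + 1) * exp (- \<alpha> * t))\<^sup>2"
      unfolding power_mult_distrib by (intro mult_right_mono power_mono) auto
    finally show "(norm (x t - average_state (x 0)))\<^sup>2
        \<le> ((norm (x 0 - average_state (x 0)) + 1) * exp (- \<alpha> * t))\<^sup>2" .
  qed simp
  then have "exponentially_converges x (average_state (x 0))"
    unfolding exponentially_converges_def using \<open>\<alpha> > 0\<close>
    by (intro exI[of _ "norm (x 0 - average_state (x 0)) + 1"] conjI exI[of _ \<alpha>])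
      (auto simp: add_nonneg_pos)
  then show ?thesis
    using exponentially_converges_imp_tendsto by blast
qed

end
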